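(* For all $k\ge1$, $n\ge0$ and $0\le q\le k$, we have $F_k^q(n+1)-F_k^q(n)=0$ if and only if $\mathrm{rank}_k(n)<q$. In particular $F_k(n+1)=F_k(n)$ if and only if $\mathrm{rank}_k(n)=0$.
   Context: For $k\ge1$, $F_k:\mathbb{N}\to\mathbb{N}$ is defined by $F_k(0)=0$ and $F_k(n)=n-F_k^k(n-1)$ for $n\ge1$, where $F_k^j$ denotes the $j$-th iterate of $F_k$ ($F_k^0$ is the identity). The sequence $(A_{k,p})_{p\ge0}$ is defined by $A_{k,p}=p+1$ for $0\le p<k$ and $A_{k,p}=A_{k,p-1}+A_{k,p-k}$ for $p\ge k$. For $n\ge0$, $D_k(n)$ denotes the unique finite set $D\subset\mathbb{N}$ whose elements are pairwise at distance at least $k$ and such that $\sum_{p\in D}A_{k,p}=n$. The $k$-rank $\mathrm{rank}_k(n)$ is the least element of $D_k(n)$, or $+\infty$ if $D_k(n)=\varnothing$ (i.e. $n=0$). *)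

theory Defs
  imports Main "HOL-Library.Extended_Nat"
begin

text \<open>
  The recursion \<open>Fseq k n = n - (Fseq k ^^ k) (n - 1)\<close> is nested, with a variable number of
  nested calls, so \<open>Fseq k\<close> is built by tabulation: \<open>Fseq_upto k n\<close> agrees with \<open>Fseq k\<close> on
  \<open>{0..n}\<close> and is 0 beyond. The defining equations of \<open>Fseq\<close> are \<open>Fseq_0\<close> and \<open>Fseq_rec\<close> below.
\<close>

primrec Fseq_upto :: "nat \<Rightarrow> nat \<Rightarrow> nat \<Rightarrow> nat" where
  "Fseq_upto k 0 = (\<lambda>_. 0)"
| "Fseq_upto k (Suc n) = (Fseq_upto k n)(Suc n := Suc n - (Fseq_upto k n ^^ k) n)"

definition Fseq :: "nat \<Rightarrow> nat \<Rightarrow> nat" where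
  "Fseq k n = Fseq_upto k n n"

lemma Fseq_upto_le: "Fseq_upto k n m \<le> m"
  by (induction n) auto

lemma Fseq_le: "Fseq k n \<le> n"
  unfolding Fseq_def by (rule Fseq_upto_le)

lemma Fseq_pow_le: "(Fseq k ^^ j) n \<le> n"
  by (induction j) (auto intro: order_trans[OF Fseq_le])

lemma Fseq_upto_eq_Fseq: "m \<le> n \<Longrightarrow> Fseq_upto k n m = Fseq k m"
  by (induction n) (auto simp: Fseq_def le_Suc_eq)

lemma Fseq_upto_pow: "(Fseq_upto k n ^^ j) n = (Fseq k ^^ j) n"
  by (induction j) (simp_all add: Fseq_upto_eq_Fseq Fseq_pow_le)

lemma Fseq_0: "Fseq k 0 = 0"
  by (simp add: Fseq_def)

text \<open>By \<open>Fseq_pow_le\<close>, the subtraction on the right-hand side is never truncated.\<close>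

lemma Fseq_rec: "n \<ge> 1 \<Longrightarrow> Fseq k n = n - (Fseq k ^^ k) (n - 1)"
  by (cases n) (simp_all add: Fseq_def[of k "Suc _"] Fseq_upto_pow)

text \<open>The disjunct \<open>k = 0\<close> only serves termination; the sequences are used for \<open>k \<ge> 1\<close>.\<close>

fun Aseq :: "nat \<Rightarrow> nat \<Rightarrow> nat" where
  "Aseq k p = (if p < k \<or> k = 0 then p + 1 else Aseq k (p - 1) + Aseq k (p - k))"

declare Aseq.simps [simp del]

definition k_sparse :: "nat \<Rightarrow> nat set \<Rightarrow> bool" where
  "k_sparse k D \<longleftrightarrow> (\<forall>p\<in>D. \<forall>q\<in>D. p < q \<longrightarrow> k \<le> q - p)"

definition decomp :: "nat \<Rightarrow> nat \<Rightarrow> nat set" where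
  "decomp k n = (THE D. finite D \<and> k_sparse k D \<and> (\<Sum>p\<in>D. Aseq k p) = n)"

definition k_rank :: "nat \<Rightarrow> nat \<Rightarrow> enat" where
  "k_rank k n = (if decomp k n = {} then \<infinity> else enat (LEAST p. p \<in> decomp k n))"

end

theory Submission
  imports Defs
begin

text \<open>
  For \<open>q \<le> k\<close> let \<open>G\<^sub>q(n)\<close> be the sum of the \<open>A\<^sub>k\<^sub>,\<^sub>p\<^sub>-\<^sub>q\<close> over \<open>p \<in> D\<^sub>k(n)\<close>, with \<open>p - q\<close> cut off at 0.
  Adding 1 to \<open>n\<close> inserts 0 into \<open>D\<^sub>k(n)\<close> if the rank is at least \<open>k\<close>, and otherwise replaces the
  least element \<open>r\<close> by \<open>r + 1\<close> and propagates carries \<open>A\<^sub>p + A\<^sub>p\<^sub>+\<^sub>k\<^sub>-\<^sub>1 = A\<^sub>p\<^sub>+\<^sub>k\<close>. The carries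
  remain valid after shifting all indices down by \<open>q \<le> k\<close>, because \<open>A\<^sub>0 + A\<^sub>m = A\<^sub>m\<^sub>+\<^sub>1\<close> for \<open>m < k\<close>.
  Hence \<open>G\<^sub>q(n + 1) - G\<^sub>q(n)\<close> is 0 if the rank of \<open>n\<close> is less than \<open>q\<close>, and 1 otherwise. Comparing
  increments yields \<open>G\<^sub>j\<^sub>+\<^sub>1 = G\<^sub>1 \<circ> G\<^sub>j\<close> for \<open>j < k\<close> and \<open>G\<^sub>1(n + 1) + G\<^sub>k(n) = n + 1\<close>, so \<open>G\<^sub>1\<close> satisfies
  the recursion of \<open>F\<^sub>k\<close> and \<open>G\<^sub>q\<close> is the \<open>q\<close>-th iterate of \<open>F\<^sub>k\<close>.
\<close>

section \<open>The sequence \<open>Aseq\<close>: values, growth and carries\<close>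

lemma Aseq_small: "p < k \<Longrightarrow> Aseq k p = Suc p"
  by (subst Aseq.simps) simp

lemma Aseq_0: "Aseq k 0 = 1"
  by (subst Aseq.simps) simp

lemma Aseq_rec: "k \<ge> 1 \<Longrightarrow> p \<ge> k \<Longrightarrow> Aseq k p = Aseq k (p - 1) + Aseq k (p - k)"
  by (subst Aseq.simps) simp

text \<open>At \<open>Suc m = k\<close> the recursion adds \<open>Aseq k 0 = 1\<close>, so unit
  growth extends one index past the initial segment.\<close>

lemma Aseq_Suc_small: "m < k \<Longrightarrow> Aseq k (Suc m) = Suc (Aseq k m)"
  by (cases "Suc m = k") (auto simp: Aseq_small Aseq_rec Aseq_0)

lemma Aseq_pos: "0 < Aseq k p"
proof (induction p rule: less_induct)
  case (less p)
  then show ?case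
    by (subst Aseq.simps) auto
qed

lemma Aseq_mono:
  assumes "k \<ge> 1" "m \<le> n"
  shows "Aseq k m \<le> Aseq k n"
proof -
  have "Aseq k p \<le> Aseq k (Suc p)" for p
    using assms(1) by (cases "p < k") (auto simp: Aseq_Suc_small Aseq_rec)
  then show ?thesis
    using assms(2) by (rule lift_Suc_mono_le)
qed

text \<open>For \<open>q \<le> p\<close> this is the recursion at index \<open>p + k - q\<close>.
  Otherwise \<open>p - q\<close> truncates to 0 and a unit step remains; \<open>1 \<le> p\<close>
  keeps \<open>p + k - 1 - q\<close> a true difference even for \<open>q = k\<close>.\<close>

lemma Aseq_carry:
  assumes "1 \<le> p" "q \<le> k" "k \<ge> 1"
  shows "Aseq k (p - q) + Aseq k (p + k - 1 - q) = Aseq k (p + k - q)"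
proof (cases "q \<le> p")
  case True
  then show ?thesis
    using assms Aseq_rec[of k "p + k - q"] by (simp add: diff_right_commute)
next
  case False
  then have "p + k - q = Suc (p + k - 1 - q)" "p + k - 1 - q < k"
    using assms by auto
  then show ?thesis
    using False Aseq_Suc_small[of "p + k - 1 - q" k] by (simp add: Aseq_0)
qed

section \<open>Canonical index sets and their shifted sums\<close>

definition canonical :: "nat \<Rightarrow> nat set \<Rightarrow> bool" where
  "canonical k D \<longleftrightarrow> finite D \<and> k_sparse k D"

text \<open>The sum runs over \<open>D\<close>, not over the shifted indices, because truncation can
  merge them: for \<open>q = k\<close> both \<open>0\<close> and \<open>k\<close> go to
  \<open>0\<close> and have to count twice.\<close>

definition shift_sum :: "nat \<Rightarrow> nat \<Rightarrow> nat set \<Rightarrow> nat" where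
  "shift_sum k q D = (\<Sum>p\<in>D. Aseq k (p - q))"

lemma canonical_finite: "canonical k D \<Longrightarrow> finite D"
  by (simp add: canonical_def)

lemma canonical_empty [simp]: "canonical k {}"
  by (simp add: canonical_def k_sparse_def)

lemma canonical_subset: "canonical k D \<Longrightarrow> E \<subseteq> D \<Longrightarrow> canonical k E"
  by (auto simp: canonical_def k_sparse_def intro: finite_subset)

lemma canonical_insert_least:
  assumes "canonical k D" "\<And>x. x \<in> D \<Longrightarrow> p + k \<le> x"
  shows "canonical k (insert p D)"
  using assms unfolding canonical_def k_sparse_def by fastforce

lemma canonicalD: "canonical k D \<Longrightarrow> p \<in> D \<Longrightarrow> x \<in> D \<Longrightarrow> p < x \<Longrightarrow> p + k \<le> x"
  unfolding canonical_def k_sparse_def by fastforce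

lemma shift_sum_empty [simp]: "shift_sum k q {} = 0"
  by (simp add: shift_sum_def)

lemma shift_sum_insert:
  "finite D \<Longrightarrow> p \<notin> D \<Longrightarrow> shift_sum k q (insert p D) = Aseq k (p - q) + shift_sum k q D"
  by (simp add: shift_sum_def)

lemma shift_sum_remove:
  "finite D \<Longrightarrow> p \<in> D \<Longrightarrow> shift_sum k q D = Aseq k (p - q) + shift_sum k q (D - {p})"
  unfolding shift_sum_def by (rule sum.remove)

section \<open>Uniqueness of the decomposition\<close>

lemma shift_sum_less:
  assumes "k \<ge> 1" "canonical k D" "\<And>p. p \<in> D \<Longrightarrow> p < m"
  shows "shift_sum k 0 D < Aseq k m"
  using assms(2,3)
proof (induction m arbitrary: D rule: less_induct)
  case (less m)
  show ?case
  proof (cases "D = {}")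
    case True
    then show ?thesis by (simp add: Aseq_pos)
  next
    case False
    define p where "p = Max D"
    have fin: "finite D" using less.prems(1) by (rule canonical_finite)
    have p: "p \<in> D" "p < m" and le: "\<And>x. x \<in> D \<Longrightarrow> x \<le> p"
      using False fin less.prems(2) by (auto simp: p_def)
    have gap: "x + k \<le> p" if "x \<in> D - {p}" for x
      using canonicalD[OF less.prems(1), of x p] le[of x] that p(1) by force
    \<comment> \<open>If \<open>k \<le> p\<close>, the indices other than the maximum
      \<open>p\<close> lie below \<open>Suc p - k\<close>, so their sum is less than the second
      summand of \<open>Aseq k (Suc p) = Aseq k p + Aseq k (Suc p - k)\<close>. If
      \<open>p < k\<close>, there are none.\<close>
    have "shift_sum k 0 D < Aseq k (Suc p)"
    proof (cases "k \<le> p")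
      case True
      have "shift_sum k 0 (D - {p}) < Aseq k (Suc p - k)"
      proof (rule less.IH)
        show "Suc p - k < m" using assms(1) p by linarith
        show "canonical k (D - {p})" by (rule canonical_subset[OF less.prems(1)]) auto
        show "x < Suc p - k" if "x \<in> D - {p}" for x using gap[OF that] by linarith
      qed
      then show ?thesis
        using shift_sum_remove[OF fin p(1), of k 0] Aseq_rec[of k "Suc p"] assms(1) True by simp
    next
      case False
      then have "D - {p} = {}" using gap by fastforce
      then show ?thesis
        using shift_sum_remove[OF fin p(1), of k 0, unfolded \<open>D - {p} = {}\<close>]
          False Aseq_Suc_small[of p k] by simp
    qed
    also have "\<dots> \<le> Aseq k m" using p(2) assms(1) by (intro Aseq_mono) auto
    finally show ?thesis .
  qed
qed

text \<open>By \<open>shift_sum_less\<close>, a set with smaller maximum sums to less than the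
  largest term of the other. Hence the maxima agree and can be removed.\<close>

lemma canonical_unique:
  assumes "k \<ge> 1" "canonical k D" "canonical k E" "shift_sum k 0 D = shift_sum k 0 E"
  shows "D = E"
  using assms(2-)
proof (induction "card D" arbitrary: D E rule: less_induct)
  case less
  note fin = canonical_finite[OF less.prems(1)] canonical_finite[OF less.prems(2)]
  have ne: "X = {}" if "shift_sum k 0 X = 0" "finite X" for X
  proof (rule ccontr)
    assume "X \<noteq> {}"
    then obtain p where "p \<in> X" by blast
    then show False
      using that shift_sum_remove[of X p k 0] Aseq_pos[of k p] by simp
  qed
  have Max_le: "Max X \<le> Max Y"
    if "canonical k X" "canonical k Y" "X \<noteq> {}" "Y \<noteq> {}" "shift_sum k 0 X = shift_sum k 0 Y"
    for X Y
  proof (rule ccontr)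
    assume less: "\<not> Max X \<le> Max Y"
    note f = canonical_finite[OF that(1)] canonical_finite[OF that(2)]
    have "shift_sum k 0 Y < Aseq k (Max X)"
      using less f(2) that by (intro shift_sum_less[OF assms(1)]) (auto simp: not_le intro: le_less_trans)
    also have "\<dots> \<le> shift_sum k 0 X"
      using shift_sum_remove[OF f(1) Max_in[OF f(1) that(3)], of k 0] by simp
    finally show False using that(5) by simp
  qed
  show ?case
  proof (cases "D = {} \<or> E = {}")
    case True
    then show ?thesis using ne[of D] ne[of E] fin less.prems(3) by auto
  next
    case False
    define p where "p = Max D"
    have "Max E = p"
      unfolding p_def using Max_le[of D E] Max_le[of E D] less.prems False by (intro antisym) auto
    then have p: "p \<in> D" "p \<in> E"
      using False fin Max_in[of D] Max_in[of E] by (auto simp: p_def)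
    have "D - {p} = E - {p}"
    proof (rule less.hyps)
      show "card (D - {p}) < card D" using p fin by (intro card_Diff1_less)
      show "canonical k (D - {p})" "canonical k (E - {p})"
        using less.prems by (auto intro: canonical_subset)
      show "shift_sum k 0 (D - {p}) = shift_sum k 0 (E - {p})"
        using less.prems(3) shift_sum_remove[OF fin(1) p(1), of k 0]
          shift_sum_remove[OF fin(2) p(2), of k 0] by simp
    qed
    then show ?thesis using p by blast
  qed
qed

section \<open>Carries and the passage from \<open>n\<close> to \<open>Suc n\<close>\<close>

lemma canonical_carry:
  assumes "k \<ge> 1" "canonical k E" "1 \<le> p" "\<And>x. x \<in> E \<Longrightarrow> p + k - 1 \<le> x"
  shows "\<exists>D. canonical k D \<and> (\<forall>x\<in>D. p \<le> x) \<and>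
    (\<forall>q\<le>k. shift_sum k q D = Aseq k (p - q) + shift_sum k q E)"
  using assms(2-)
proof (induction "card E" arbitrary: E p rule: less_induct)
  case less
  have fin: "finite E" using less.prems(1) by (rule canonical_finite)
  show ?case
  proof (cases "p + k - 1 \<in> E")
    case False
    have ge: "p + k \<le> x" if "x \<in> E" for x
      using less.prems(3)[OF that] that False by (cases "x = p + k - 1") auto
    then have "p \<notin> E" using assms(1) by force
    then show ?thesis
      using canonical_insert_least[OF less.prems(1) ge] ge shift_sum_insert[OF fin]
      by (intro exI[of _ "insert p E"]) (auto dest: ge)
  next
    case True
    define e where "e = p + k - 1"
    \<comment> \<open>The pair \<open>p\<close>, \<open>e\<close> is merged into
      \<open>p + k\<close>, which may in turn collide with \<open>p + k + k - 1\<close>. Dropping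
      \<open>e\<close> shrinks the set, so the chain of carries ends.\<close>
    have "\<exists>D. canonical k D \<and> (\<forall>x\<in>D. p + k \<le> x) \<and>
      (\<forall>q\<le>k. shift_sum k q D = Aseq k (p + k - q) + shift_sum k q (E - {e}))"
    proof (rule less.hyps)
      show "card (E - {e}) < card E" using True fin unfolding e_def by (intro card_Diff1_less)
      show "canonical k (E - {e})" by (rule canonical_subset[OF less.prems(1)]) auto
      show "1 \<le> p + k" using less.prems(2) by simp
      show "p + k + k - 1 \<le> x" if "x \<in> E - {e}" for x
      proof -
        have "e \<in> E" "x \<in> E" "x \<noteq> e" "e \<le> x"
          using True less.prems(3)[of x] that by (auto simp: e_def)
        then have "e + k \<le> x" using canonicalD[OF less.prems(1), of e x] by simp
        then show ?thesis by (simp add: e_def)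
      qed
    qed
    then obtain D where D: "canonical k D" "\<forall>x\<in>D. p + k \<le> x"
      "\<forall>q\<le>k. shift_sum k q D = Aseq k (p + k - q) + shift_sum k q (E - {e})" by blast
    \<comment> \<open>\<open>Aseq_carry\<close> holds for every \<open>q \<le> k\<close>, so one set
      \<open>D\<close> serves all shifts.\<close>
    have "shift_sum k q D = Aseq k (p - q) + shift_sum k q E" if "q \<le> k" for q
      using D(3) that Aseq_carry[OF less.prems(2) that assms(1)]
        shift_sum_remove[OF fin True, of k q] by (simp add: e_def)
    with D show ?thesis by (intro exI[of _ D]) auto
  qed
qed

lemma canonical_Suc:
  assumes "k \<ge> 1" "canonical k D"
  shows "\<exists>E. canonical k E \<and> (0 \<in> E \<longleftrightarrow> (\<forall>p\<in>D. k \<le> p)) \<and>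
    (\<forall>q\<le>k. shift_sum k q E = shift_sum k q D + (if \<exists>p\<in>D. p < q then 0 else 1))"
proof (cases "\<forall>p\<in>D. k \<le> p")
  case True
  then have "0 \<notin> D" using assms(1) by auto
  moreover have "canonical k (insert 0 D)"
    using True by (intro canonical_insert_least[OF assms(2)]) auto
  ultimately show ?thesis
    using True shift_sum_insert[OF canonical_finite[OF assms(2)]]
    by (intro exI[of _ "insert 0 D"]) (auto simp: Aseq_0)
next
  case False
  have fin: "finite D" using assms(2) by (rule canonical_finite)
  define r where "r = Min D"
  have least: "\<And>x. x \<in> D \<Longrightarrow> r \<le> x"
    using fin by (simp add: r_def)
  have r: "r \<in> D" "r < k"
  proof -
    obtain x where x: "x \<in> D" "x < k" using False by (auto simp: not_le)
    then have "D \<noteq> {}" by blast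
    then show "r \<in> D" unfolding r_def using fin by (intro Min_in)
    show "r < k" using least[OF x(1)] x(2) by simp
  qed
  have "\<exists>E. canonical k E \<and> (\<forall>x\<in>E. Suc r \<le> x) \<and>
    (\<forall>q\<le>k. shift_sum k q E = Aseq k (Suc r - q) + shift_sum k q (D - {r}))"
  proof (rule canonical_carry[OF assms(1)])
    show "canonical k (D - {r})" by (rule canonical_subset[OF assms(2)]) auto
    \<comment> \<open>Raising \<open>r\<close> to \<open>Suc r\<close> reduces its guaranteed gap to
      \<open>k - 1\<close>, just what \<open>canonical_carry\<close> tolerates.\<close>
    show "Suc r + k - 1 \<le> x" if "x \<in> D - {r}" for x
      using canonicalD[OF assms(2) r(1), of x] least[of x] that by force
  qed simp
  then obtain E where E: "canonical k E" "\<forall>x\<in>E. Suc r \<le> x"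
    "\<And>q. q \<le> k \<Longrightarrow> shift_sum k q E = Aseq k (Suc r - q) + shift_sum k q (D - {r})" by blast
  have "shift_sum k q E = shift_sum k q D + (if \<exists>p\<in>D. p < q then 0 else 1)" if "q \<le> k" for q
  proof -
    have "(\<exists>p\<in>D. p < q) \<longleftrightarrow> r < q"
      using r(1) least by (auto intro: le_less_trans)
    \<comment> \<open>For \<open>r < q\<close> both differences truncate to 0; for
      \<open>q \<le> r\<close> the index \<open>r - q\<close> is below \<open>k\<close>, where
      growth is by 1.\<close>
    moreover have "Aseq k (Suc r - q) = Aseq k (r - q) + (if r < q then 0 else 1)"
      using r(2) Aseq_Suc_small[of "r - q" k] by (auto simp: Suc_diff_le not_less)
    ultimately show ?thesis
      using E(3)[OF that] shift_sum_remove[OF fin r(1), of k q] by simp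
  qed
  moreover have "0 \<notin> E" using E(2) by auto
  ultimately show ?thesis using E(1) False by (intro exI[of _ E]) auto
qed

section \<open>Existence of the decomposition, \<open>decomp\<close> and the rank\<close>

lemma canonical_exists:
  assumes "k \<ge> 1"
  shows "\<exists>D. canonical k D \<and> shift_sum k 0 D = n"
proof (induction n)
  case 0
  show ?case by (intro exI[of _ "{}"]) simp
next
  case (Suc n)
  then obtain D where D: "canonical k D" "shift_sum k 0 D = n" by blast
  from canonical_Suc[OF assms D(1)] obtain E where "canonical k E"
    "\<forall>q\<le>k. shift_sum k q E = shift_sum k q D + (if \<exists>p\<in>D. p < q then 0 else 1)" by blast
  \<comment> \<open>At \<open>q = 0\<close> the increment is always 1.\<close>
  with D(2) show ?case by (intro exI[of _ E]) auto
qed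

lemma decomp_eqI:
  assumes "k \<ge> 1" "canonical k D" "shift_sum k 0 D = n"
  shows "decomp k n = D"
  unfolding decomp_def
proof (rule the_equality)
  show "finite D \<and> k_sparse k D \<and> (\<Sum>p\<in>D. Aseq k p) = n"
    using assms(2,3) by (simp add: canonical_def shift_sum_def)
next
  fix E
  assume "finite E \<and> k_sparse k E \<and> (\<Sum>p\<in>E. Aseq k p) = n"
  then show "E = D"
    using assms by (intro canonical_unique[OF assms(1)]) (auto simp: canonical_def shift_sum_def)
qed

lemma decomp_props:
  assumes "k \<ge> 1"
  shows canonical_decomp: "canonical k (decomp k n)"
    and shift_sum_decomp: "shift_sum k 0 (decomp k n) = n"
  using canonical_exists[OF assms, of n] decomp_eqI[OF assms] by auto

lemma decomp_0: "k \<ge> 1 \<Longrightarrow> decomp k 0 = {}"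
  by (rule decomp_eqI) auto

lemma k_rank_less_iff: "k_rank k n < enat q \<longleftrightarrow> (\<exists>p\<in>decomp k n. p < q)"
proof (cases "decomp k n = {}")
  case True
  then show ?thesis by (simp add: k_rank_def)
next
  case False
  then have "(LEAST p. p \<in> decomp k n) \<in> decomp k n" by (auto intro: LeastI)
  then show ?thesis
    using False by (auto simp: k_rank_def intro: le_less_trans[OF Least_le])
qed

section \<open>Shifted sums of the decomposition as functions of \<open>n\<close>\<close>

definition Gsum :: "nat \<Rightarrow> nat \<Rightarrow> nat \<Rightarrow> nat" where
  "Gsum k q n = shift_sum k q (decomp k n)"

lemma Gsum_at_0: "k \<ge> 1 \<Longrightarrow> Gsum k q 0 = 0"
  by (simp add: Gsum_def decomp_0)

lemma Gsum_shift_0: "k \<ge> 1 \<Longrightarrow> Gsum k 0 n = n"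
  by (simp add: Gsum_def shift_sum_decomp)

lemma decomp_Suc_props:
  assumes "k \<ge> 1"
  shows zero_in_decomp_Suc: "0 \<in> decomp k (Suc n) \<longleftrightarrow> (\<forall>p\<in>decomp k n. k \<le> p)"
    and Gsum_Suc: "q \<le> k \<Longrightarrow>
      Gsum k q (Suc n) = Gsum k q n + (if \<exists>p\<in>decomp k n. p < q then 0 else 1)"
proof -
  obtain E where E: "canonical k E" "0 \<in> E \<longleftrightarrow> (\<forall>p\<in>decomp k n. k \<le> p)"
    "\<forall>q\<le>k. shift_sum k q E =
      shift_sum k q (decomp k n) + (if \<exists>p\<in>decomp k n. p < q then 0 else 1)"
    using canonical_Suc[OF assms canonical_decomp[OF assms, of n]] by blast
  have "shift_sum k 0 E = Suc n"
    using E(3) shift_sum_decomp[OF assms, of n] by simp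
  then have "decomp k (Suc n) = E"
    using E(1) by (intro decomp_eqI[OF assms])
  then show "0 \<in> decomp k (Suc n) \<longleftrightarrow> (\<forall>p\<in>decomp k n. k \<le> p)"
    and "q \<le> k \<Longrightarrow> Gsum k q (Suc n) = Gsum k q n + (if \<exists>p\<in>decomp k n. p < q then 0 else 1)"
    using E by (auto simp: Gsum_def)
qed

text \<open>Without truncation the shift is injective and preserves gaps, so the image is canonical
  and uniqueness identifies it.\<close>

lemma decomp_Gsum:
  assumes "k \<ge> 1" "\<forall>p\<in>decomp k n. j \<le> p"
  shows "decomp k (Gsum k j n) = (\<lambda>p. p - j) ` decomp k n"
proof (rule decomp_eqI[OF assms(1)])
  note can = canonical_decomp[OF assms(1), of n]
  show "canonical k ((\<lambda>p. p - j) ` decomp k n)"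
    using can assms(2) by (auto simp: canonical_def k_sparse_def)
  have "inj_on (\<lambda>p. p - j) (decomp k n)"
    using assms(2) by (intro inj_onI) (metis eq_diff_iff)
  then show "shift_sum k 0 ((\<lambda>p. p - j) ` decomp k n) = Gsum k j n"
    by (simp add: shift_sum_def Gsum_def sum.reindex)
qed

text \<open>If some index is below \<open>j\<close>, both sides stall because
  \<open>Gsum k j\<close> does. Otherwise \<open>decomp_Gsum\<close> moves the index
  \<open>j\<close>, if present, to \<open>0\<close>, and exactly this stalls
  \<open>Gsum k 1\<close>.\<close>

lemma Gsum_compose:
  assumes "j < k"
  shows "Gsum k (Suc j) n = Gsum k 1 (Gsum k j n)"
proof (induction n)
  case 0
  show ?case using assms by (simp add: Gsum_at_0)
next
  case (Suc n)
  have k: "k \<ge> 1" using assms by simp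
  show ?case
  proof (cases "\<exists>p\<in>decomp k n. p < j")
    case True
    then have "\<exists>p\<in>decomp k n. p < Suc j" by (auto intro: less_SucI)
    then show ?thesis
      using True Suc assms by (simp add: Gsum_Suc[OF k])
  next
    case False
    then have "\<forall>p\<in>decomp k n. j \<le> p" by (auto simp: not_less)
    then have "(\<exists>p\<in>decomp k (Gsum k j n). p < 1) \<longleftrightarrow> (\<exists>p\<in>decomp k n. p < Suc j)"
      by (auto simp: decomp_Gsum[OF k] less_Suc_eq_le)
    then show ?thesis
      using False Suc assms Gsum_Suc[OF k, of j n] Gsum_Suc[OF k, of "Suc j" n]
        Gsum_Suc[OF k, of 1 "Gsum k j n"] by simp
  qed
qed

lemma Gsum_funpow:
  assumes "k \<ge> 1" "j \<le> k"
  shows "(Gsum k 1 ^^ j) n = Gsum k j n"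
  using assms(2)
proof (induction j)
  case 0
  show ?case using assms(1) by (simp add: Gsum_shift_0)
next
  case (Suc j)
  then show ?case using Gsum_compose[of j k n] by simp
qed

text \<open>Exactly one summand grows at each step: \<open>Gsum k 1\<close> stalls after
  \<open>Suc n\<close> iff \<open>0\<close> lies in \<open>decomp k (Suc n)\<close>, that is, iff no
  index of \<open>decomp k n\<close> is below \<open>k\<close>, which is when
  \<open>Gsum k k\<close> grows after \<open>n\<close>.\<close>

lemma Gsum_rec:
  assumes "k \<ge> 1"
  shows "Gsum k 1 (Suc n) + Gsum k k n = Suc n"
proof (induction n)
  case 0
  show ?case using assms by (simp add: Gsum_Suc Gsum_at_0 decomp_0)
next
  case (Suc n)
  have "(\<exists>p\<in>decomp k (Suc n). p < 1) \<longleftrightarrow> \<not> (\<exists>p\<in>decomp k n. p < k)"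
    using zero_in_decomp_Suc[OF assms, of n] by (auto simp: not_less)
  then show ?case
    using Suc Gsum_Suc[OF assms, of 1 "Suc n"] Gsum_Suc[OF assms, of k n] assms
    by (simp split: if_splits)
qed

section \<open>Identification with the iterates of \<open>Fseq\<close>\<close>

lemma Fseq_eq_Gsum:
  assumes "k \<ge> 1"
  shows "Fseq k n = Gsum k 1 n"
proof (induction n rule: less_induct)
  case (less n)
  show ?case
  proof (cases n)
    case 0
    then show ?thesis using assms by (simp add: Fseq_0 Gsum_at_0)
  next
    case (Suc m)
    \<comment> \<open>All intermediate values are at most \<open>m < n\<close>, so the induction
      hypothesis covers every nested call.\<close>
    have "(Fseq k ^^ j) m = (Gsum k 1 ^^ j) m" for j
    proof (induction j)
      case (Suc j)
      have "(Fseq k ^^ j) m < n"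
        using Fseq_pow_le[of j k m] \<open>n = Suc m\<close> by simp
      then show ?case using less.IH Suc by simp
    qed simp
    then have "Fseq k n = Suc m - Gsum k k m"
      using Suc assms Gsum_funpow[OF assms, of k m] by (simp add: Fseq_rec)
    then show ?thesis
      using Gsum_rec[OF assms, of m] Suc by simp
  qed
qed

theorem theorem4p11:
  fixes k n :: nat
  assumes "k \<ge> 1"
  shows "(\<forall>q\<le>k. int ((Fseq k ^^ q) (n + 1)) - int ((Fseq k ^^ q) n) = 0 \<longleftrightarrow> k_rank k n < enat q)
    \<and> (Fseq k (n + 1) = Fseq k n \<longleftrightarrow> k_rank k n = 0)"
proof -
  have "Fseq k = Gsum k 1"
    using Fseq_eq_Gsum[OF assms] by (rule ext)
  then have iter: "(Fseq k ^^ q) m = Gsum k q m" if "q \<le> k" for q m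
    using Gsum_funpow[OF assms that] by simp
  have main: "(Fseq k ^^ q) (n + 1) = (Fseq k ^^ q) n \<longleftrightarrow> k_rank k n < enat q" if "q \<le> k" for q
    using that by (simp add: iter Gsum_Suc[OF assms] k_rank_less_iff)
  \<comment> \<open>The second claim is the case \<open>q = 1\<close>.\<close>
  have "k_rank k n < enat 1 \<longleftrightarrow> k_rank k n = 0"
    by (cases "k_rank k n") (auto simp: zero_enat_def)
  with main[of 1] main assms show ?thesis by auto
qed

end
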